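(* Let $K\ge1$, $\Delta t>0$, $C_0\in\mathbb R$, and let $\boldsymbol G_K,\boldsymbol L_K\in\mathbb R^{K\times K}$ satisfy $\boldsymbol L_K=\boldsymbol L_K^{T}\succeq0$ and $\boldsymbol z^{T}\boldsymbol G_K\boldsymbol z\le0$ for all $\boldsymbol z\in\mathbb R^K$. Let $(\boldsymbol c^n,r^n)_{n\ge0}$ and $(\boldsymbol d^{n+1/2})_{n\ge0}$, with $\boldsymbol c^n,\boldsymbol d^{n+1/2}\in\mathbb R^K$ and $r^n\in\mathbb R$, be any solution of the fully discrete CARE-SAV scheme: for every $n\ge0$, $$\frac{\boldsymbol c^{n+1}-\boldsymbol c^n}{\Delta t}=\boldsymbol G_K\boldsymbol d^{n+1/2},$$ $$\boldsymbol d^{n+1/2}=\boldsymbol L_K\frac{\boldsymbol c^{n+1}+\boldsymbol c^n}{2}+\frac{r^{n+1}+r^n}{2}\,\boldsymbol b^{n+1/2},$$ $$\frac{r^{n+1}-r^n}{\Delta t}=\frac12(\boldsymbol b^{n+1/2})^{T}\frac{\boldsymbol c^{n+1}-\boldsymbol c^n}{\Delta t},$$ where $\boldsymbol b^{n+1/2}=\boldsymbol b_K(\overline{\boldsymbol c}^{\,n+1/2})\in\mathbb R^K$. Define the modified energy $$\widetilde E_K^n=\frac12(\boldsymbol c^n)^{T}\boldsymbol L_K\boldsymbol c^n+(r^n)^2-C_0.$$ Then for every $n\ge0$ $$\widetilde E_K^{n+1}-\widetilde E_K^n=\Delta t\,(\boldsymbol d^{n+1/2})^{T}\boldsymbol G_K\boldsymbol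 d^{n+1/2}\le0 .$$ Consequently the scheme is unconditionally energy stable with respect to the modified energy, i.e. $\widetilde E_K^n$ is nonincreasing in $n$ for every $\Delta t>0$.
   Context: $\boldsymbol G_K$ and $\boldsymbol L_K$ are the reduced matrices of the mobility operator and of the linear energy operator of a gradient flow $\partial_t\phi=\mathcal G\mu$, $\mu=\mathcal L\phi+\mathcal U(\phi)$, in a $K$-dimensional Galerkin space; $\boldsymbol b_K$ maps a coefficient vector in $\mathbb R^K$ to a vector in $\mathbb R^K$ (the projected SAV nonlinearity). The extrapolated coefficient vector is $\overline{\boldsymbol c}^{\,n+1/2}=(3\boldsymbol c^n-\boldsymbol c^{n-1})/2$ for $n\ge1$ and $\overline{\boldsymbol c}^{\,1/2}=\boldsymbol c^0$. $C_0$ is the constant shift used in the SAV reformulation. *)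

theory Defs
  imports "HOL-Analysis.Analysis"
begin

definition symmetric_psd :: "real^'k^'k \<Rightarrow> bool" where
  "symmetric_psd A \<longleftrightarrow> transpose A = A \<and> (\<forall>z. 0 \<le> z \<bullet> (A *v z))"

text \<open>Quantities at half-integer time levels are indexed by the integer level below:
  \<open>extrapolated c n\<close> and \<open>d n\<close> stand for the values at level \<open>n + 1/2\<close>.\<close>

definition extrapolated :: "(nat \<Rightarrow> real^'k) \<Rightarrow> nat \<Rightarrow> real^'k" where
  "extrapolated c n = (if n = 0 then c 0 else (3 *\<^sub>R c n - c (n - 1)) /\<^sub>R 2)"

definition care_sav_solution ::
  "real \<Rightarrow> real^'k^'k \<Rightarrow> real^'k^'k \<Rightarrow> (real^'k \<Rightarrow> real^'k) \<Rightarrow>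
    (nat \<Rightarrow> real^'k) \<Rightarrow> (nat \<Rightarrow> real) \<Rightarrow> (nat \<Rightarrow> real^'k) \<Rightarrow> bool" where
  "care_sav_solution dt G L b c r d \<longleftrightarrow>
    (\<forall>n. (c (Suc n) - c n) /\<^sub>R dt = G *v d n \<and>
         d n = L *v ((c (Suc n) + c n) /\<^sub>R 2)
               + ((r (Suc n) + r n) / 2) *\<^sub>R b (extrapolated c n) \<and>
         (r (Suc n) - r n) / dt
           = 1 / 2 * (b (extrapolated c n) \<bullet> ((c (Suc n) - c n) /\<^sub>R dt)))"

definition modified_energy ::
  "real^'k^'k \<Rightarrow> real \<Rightarrow> (nat \<Rightarrow> real^'k) \<Rightarrow> (nat \<Rightarrow> real) \<Rightarrow> nat \<Rightarrow> real" where
  "modified_energy L C0 c r n = 1 / 2 * (c n \<bullet> (L *v c n)) + (r n)\<^sup>2 - C0"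

end

theory Submission
  imports Defs
begin

text \<open>The update of \<open>c\<close> is driven by \<open>G *v d n\<close>, so the dissipation
  \<open>dt * (d n \<bullet> (G *v d n))\<close> is the inner product of \<open>d n\<close> with the increment of \<open>c\<close>.
  The discrete chemical potential \<open>d n\<close> is built from midpoints, and pairing a midpoint with
  an increment is an exact difference of squares. For the linear part this gives the increment
  of the quadratic form of \<open>L\<close> (\<open>inner_diff_matrix_sum\<close>). For the nonlinear part,
  the third equation of the scheme makes the inner product of \<open>b\<close> with the increment of \<open>c\<close>
  equal to twice the increment of \<open>r\<close>, and the midpoint of \<open>r\<close> turns this into the increment
  of \<open>r\<^sup>2\<close>. The second and third equations evaluate \<open>b\<close> at the same extrapolated point,
  so \<open>b\<close> is eliminated exactly, with no remainder in the step size: this is why the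
  stability is unconditional. The sign of the increment (\<open>modified_energy_increment\<close>) is
  then that of the quadratic form of \<open>G\<close>.\<close>

text \<open>Polarization: symmetry cancels the two mixed terms.\<close>

lemma inner_diff_matrix_sum:
  fixes A :: "real^'k^'k"
  assumes "transpose A = A"
  shows "(x - y) \<bullet> (A *v (x + y)) = x \<bullet> (A *v x) - y \<bullet> (A *v y)"
proof -
  have "x \<bullet> (A *v y) = y \<bullet> (A *v x)"
    using dot_lmul_matrix[of x A y] transpose_matrix_vector[of A x] assms
    by (simp only: inner_commute)
  then show ?thesis
    by (simp add: matrix_vector_right_distrib inner_diff_left inner_add_right)
qed

lemma modified_energy_increment:
  fixes G L :: "real^'k^'k"
  assumes "dt > 0" and sym: "transpose L = L" and sol: "care_sav_solution dt G L b c r d"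
  shows "modified_energy L C0 c r (Suc n) - modified_energy L C0 c r n
           = dt * (d n \<bullet> (G *v d n))"
proof -
  define v where "v = c (Suc n) - c n"
  define s where "s = c (Suc n) + c n"
  define \<beta> where "\<beta> = b (extrapolated c n)"
  have G: "v /\<^sub>R dt = G *v d n"
    and d: "d n = L *v (s /\<^sub>R 2) + ((r (Suc n) + r n) / 2) *\<^sub>R \<beta>"
    and r: "(r (Suc n) - r n) / dt = 1 / 2 * (\<beta> \<bullet> (v /\<^sub>R dt))"
    using sol unfolding care_sav_solution_def v_def s_def \<beta>_def by blast+
  have v: "v = dt *\<^sub>R (G *v d n)"
    unfolding G[symmetric] using \<open>dt > 0\<close> by simp
  have \<beta>v: "\<beta> \<bullet> v = 2 * (r (Suc n) - r n)"
    using arg_cong[OF r, of "\<lambda>t. 2 * dt * t"] \<open>dt > 0\<close> by simp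
  have "dt * (d n \<bullet> (G *v d n)) = v \<bullet> d n"
    by (subst v) (simp add: inner_commute)
  also have "\<dots> = 1 / 2 * (v \<bullet> (L *v s)) + (r (Suc n) + r n) / 2 * (\<beta> \<bullet> v)"
    by (subst d) (simp add: inner_add_right matrix_vector_mult_scaleR inner_commute)
  also have "v \<bullet> (L *v s) = c (Suc n) \<bullet> (L *v c (Suc n)) - c n \<bullet> (L *v c n)"
    unfolding v_def s_def by (rule inner_diff_matrix_sum[OF sym])
  also have "(r (Suc n) + r n) / 2 * (\<beta> \<bullet> v) = (r (Suc n))\<^sup>2 - (r n)\<^sup>2"
    unfolding \<beta>v by (simp add: power2_eq_square field_simps)
  finally show ?thesis
    by (simp add: modified_energy_def algebra_simps)
qed

theorem theorem2:
  fixes G L :: "real^'k^'k"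
    and b :: "real^'k \<Rightarrow> real^'k"
    and dt C0 :: real
    and c d :: "nat \<Rightarrow> real^'k"
    and r :: "nat \<Rightarrow> real"
  assumes "dt > 0"
    and "symmetric_psd L"
    and "\<forall>z. z \<bullet> (G *v z) \<le> 0"
    and "care_sav_solution dt G L b c r d"
  shows "(\<forall>n. modified_energy L C0 c r (Suc n) - modified_energy L C0 c r n
                = dt * (d n \<bullet> (G *v d n))
            \<and> dt * (d n \<bullet> (G *v d n)) \<le> 0)
       \<and> decseq (modified_energy L C0 c r)"
proof -
  have increment: "modified_energy L C0 c r (Suc n) - modified_energy L C0 c r n
      = dt * (d n \<bullet> (G *v d n))" for n
    using assms modified_energy_increment unfolding symmetric_psd_def by blast
  have dissipation: "dt * (d n \<bullet> (G *v d n)) \<le> 0" for n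
    using assms(1,3) by (simp add: mult_nonneg_nonpos)
  have "modified_energy L C0 c r (Suc n) \<le> modified_energy L C0 c r n" for n
    using increment[of n] dissipation[of n] by linarith
  then show ?thesis
    unfolding decseq_Suc_iff using increment dissipation by blast
qed

end
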